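(* Let $M$ be a non-commutative magma with non-empty center. Then the direct power $M^{\infty}$ is not $\mathbf{q}_\omega$-compact (in the language $\mathcal{L}_s(M^\infty)$).
   Context: A magma is a set with an arbitrary binary operation, i.e. an algebraic structure of the language $\mathcal{L}_s=\{\cdot\}$. A magma $M$ is commutative if $xy=yx$ for all $x,y\in M$; its center is $\{c\in M\mid cx=xc \text{ for all } x\in M\}$. $M^\infty=\prod_{i=1}^\infty M$ is the magma of all sequences $(m_1,m_2,\dots)$ with $m_i\in M$ and componentwise operation. For a magma $H$, $\mathcal{L}_s(H)$ is $\mathcal{L}_s$ extended by a constant symbol for every element of $H$ (interpreted as that element). An $\mathcal{L}_s(H)$-equation is an equality $p(X)=q(X)$ of two terms of $\mathcal{L}_s(H)$. A system is an arbitrary set of equations in a finite set of variables $X=\{x_1,\dots,x_n\}$; $\mathrm{V}_H(\mathbf{S})\subseteq H^n$ denotes its set of solutions in $H$. A magma $H$ is $\mathbf{q}_\omega$-compact if for every infinite system $\mathbf{S}$ of $\mathcal{L}_s(H)$-equations (in finitely many variables $X$) and every $\mathcal{L}_s(H)$-equation $p(X)=q(X)$ with $\mathrm{V}_H(\mathbf{S})\subseteq \mathrm{V}_H(p(X)=q(X))$ there is a finite subsystem $\mathbf{S}'\subseteq\mathbf{S}$ with $\mathrm{V}_H(\mathbf{S}')\subseteq \mathrm{V}_H(p(X)=q(X))$. *)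

theory Defs
  imports Main "HOL-Library.FuncSet"
begin

locale magma =
  fixes M :: "'a set" and f :: "'a \<Rightarrow> 'a \<Rightarrow> 'a"
  assumes closed: "x \<in> M \<Longrightarrow> y \<in> M \<Longrightarrow> f x y \<in> M"

definition commutative_magma :: "'a set \<Rightarrow> ('a \<Rightarrow> 'a \<Rightarrow> 'a) \<Rightarrow> bool" where
  "commutative_magma M f \<longleftrightarrow> magma M f \<and> (\<forall>x\<in>M. \<forall>y\<in>M. f x y = f y x)"

definition magma_center :: "'a set \<Rightarrow> ('a \<Rightarrow> 'a \<Rightarrow> 'a) \<Rightarrow> 'a set" where
  "magma_center M f = {c \<in> M. \<forall>x\<in>M. f c x = f x c}"

text \<open>The sequences are indexed by all of \<open>nat\<close>, i.e. from 0 instead of from 1.\<close>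

definition power_carrier :: "'a set \<Rightarrow> (nat \<Rightarrow> 'a) set" where
  "power_carrier M = {s. \<forall>i. s i \<in> M}"

definition power_op :: "('a \<Rightarrow> 'a \<Rightarrow> 'a) \<Rightarrow> (nat \<Rightarrow> 'a) \<Rightarrow> (nat \<Rightarrow> 'a) \<Rightarrow> (nat \<Rightarrow> 'a)" where
  "power_op f s t = (\<lambda>i. f (s i) (t i))"

lemma magma_power: "magma M f \<Longrightarrow> magma (power_carrier M) (power_op f)"
  by (simp add: magma_def power_carrier_def power_op_def)

datatype 'h magma_term =
    Var nat
  | Const 'h
  | App "'h magma_term" "'h magma_term"

type_synonym 'h equation = "'h magma_term \<times> 'h magma_term"

primrec term_vars :: "'h magma_term \<Rightarrow> nat set" where
  "term_vars (Var i) = {i}"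
| "term_vars (Const h) = {}"
| "term_vars (App s t) = term_vars s \<union> term_vars t"

primrec term_consts :: "'h magma_term \<Rightarrow> 'h set" where
  "term_consts (Var i) = {}"
| "term_consts (Const h) = {h}"
| "term_consts (App s t) = term_consts s \<union> term_consts t"

primrec eval_term :: "('h \<Rightarrow> 'h \<Rightarrow> 'h) \<Rightarrow> (nat \<Rightarrow> 'h) \<Rightarrow> 'h magma_term \<Rightarrow> 'h" where
  "eval_term f x (Var i) = x i"
| "eval_term f x (Const h) = h"
| "eval_term f x (App s t) = f (eval_term f x s) (eval_term f x t)"

definition terms_over :: "'h set \<Rightarrow> nat \<Rightarrow> 'h magma_term set" where
  "terms_over H n = {t. term_vars t \<subseteq> {1..n} \<and> term_consts t \<subseteq> H}"

definition equations_over :: "'h set \<Rightarrow> nat \<Rightarrow> 'h equation set" where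
  "equations_over H n = terms_over H n \<times> terms_over H n"

text \<open>Points of \<open>H\<^sup>n\<close> are the extensional functions from \<open>{1..n}\<close> to \<open>H\<close>.\<close>

definition solutions ::
    "'h set \<Rightarrow> ('h \<Rightarrow> 'h \<Rightarrow> 'h) \<Rightarrow> nat \<Rightarrow> 'h equation set \<Rightarrow> (nat \<Rightarrow> 'h) set" where
  "solutions H f n S =
     {x \<in> {1..n} \<rightarrow>\<^sub>E H. \<forall>(p, q) \<in> S. eval_term f x p = eval_term f x q}"

definition q_omega_compact :: "'h set \<Rightarrow> ('h \<Rightarrow> 'h \<Rightarrow> 'h) \<Rightarrow> bool" where
  "q_omega_compact H f \<longleftrightarrow>
     (\<forall>n\<ge>1. \<forall>S \<subseteq> equations_over H n. \<forall>e \<in> equations_over H n.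
        infinite S \<longrightarrow> solutions H f n S \<subseteq> solutions H f n {e} \<longrightarrow>
        (\<exists>S' \<subseteq> S. finite S' \<and> solutions H f n S' \<subseteq> solutions H f n {e}))"

end

theory Submission
  imports Defs
begin

text \<open>
  Choose \<open>a, b \<in> M\<close> with \<open>f a b \<noteq> f b a\<close> and a central \<open>c\<close>. The condition that \<open>x\<close> commutes with
  the constant sequence \<open>a, a, \<dots>\<close> is checked one coordinate at a time, and its \<open>k\<close>-th coordinate
  can be isolated in a single equation: \<open>x\<close> commutes with the sequence that is \<open>a\<close> at \<open>k\<close> and \<open>c\<close>
  elsewhere, because commuting with \<open>c\<close> imposes nothing on the other coordinates. So the infinite
  system of these equations, one for each \<open>k\<close>, entails the commutation with \<open>a, a, \<dots>\<close>. Finitely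
  many of them leave some coordinate \<open>k\<close> unconstrained, and the sequence that is \<open>b\<close> at \<open>k\<close> and \<open>c\<close>
  elsewhere solves these but does not commute with \<open>a, a, \<dots>\<close>.
\<close>

definition commuting_eq :: "'h \<Rightarrow> 'h equation" where
  "commuting_eq h = (App (Var 1) (Const h), App (Const h) (Var 1))"

lemma inj_commuting_eq: "inj commuting_eq"
  by (auto simp: inj_def commuting_eq_def)

lemma commuting_eq_in_equations_over: "h \<in> H \<Longrightarrow> commuting_eq h \<in> equations_over H 1"
  by (simp add: commuting_eq_def equations_over_def terms_over_def)

lemma solutions_commuting_eqs:
  "solutions H g 1 (commuting_eq ` A) = {x \<in> {1..1} \<rightarrow>\<^sub>E H. \<forall>h\<in>A. g (x 1) h = g h (x 1)}"
  by (auto simp: solutions_def commuting_eq_def)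

lemma solutions_commuting_eq:
  "solutions H g 1 {commuting_eq h} = {x \<in> {1..1} \<rightarrow>\<^sub>E H. g (x 1) h = g h (x 1)}"
  using solutions_commuting_eqs[of H g "{h}"] by simp

text \<open>
  For equations in one variable, a failure of compactness can be exhibited entirely inside the
  magma: an element commutes with \<open>d\<close> once it commutes with all of \<open>A\<close>, but no finite part of \<open>A\<close>
  suffices for this.
\<close>

lemma not_q_omega_compact_if_commuting_not_finitary:
  assumes "infinite A" "A \<subseteq> H" "d \<in> H"
    and entails: "\<And>y. y \<in> H \<Longrightarrow> \<forall>h\<in>A. g y h = g h y \<Longrightarrow> g y d = g d y"
    and witness: "\<And>B. finite B \<Longrightarrow> B \<subseteq> A \<Longrightarrow> \<exists>y\<in>H. (\<forall>h\<in>B. g y h = g h y) \<and> g y d \<noteq> g d y"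
  shows "\<not> q_omega_compact H g"
proof
  assume compact: "q_omega_compact H g"
  let ?S = "commuting_eq ` A" and ?e = "commuting_eq d"
  have "infinite ?S"
    using \<open>infinite A\<close> finite_image_iff[OF inj_on_subset[OF inj_commuting_eq subset_UNIV]] by blast
  moreover have "?S \<subseteq> equations_over H 1"
    by (intro image_subsetI commuting_eq_in_equations_over subsetD[OF assms(2)])
  moreover have "?e \<in> equations_over H 1"
    using assms(3) by (rule commuting_eq_in_equations_over)
  moreover have "solutions H g 1 ?S \<subseteq> solutions H g 1 {?e}"
    unfolding solutions_commuting_eqs solutions_commuting_eq
  proof safe
    fix x :: "nat \<Rightarrow> _" assume "x \<in> {1..1} \<rightarrow>\<^sub>E H" "\<forall>h\<in>A. g (x 1) h = g h (x 1)"
    then show "g (x 1) d = g d (x 1)"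
      by (intro entails) (auto dest: PiE_mem)
  qed
  ultimately obtain S' where "S' \<subseteq> ?S" "finite S'"
    and sub: "solutions H g 1 S' \<subseteq> solutions H g 1 {?e}"
    using compact[unfolded q_omega_compact_def, rule_format, of 1 ?S ?e] by auto
  then obtain B where B: "B \<subseteq> A" "finite B" "S' = commuting_eq ` B"
    using finite_subset_image[of S' commuting_eq A] by blast
  then obtain y where y: "y \<in> H" "\<forall>h\<in>B. g y h = g h y" "g y d \<noteq> g d y"
    using witness by blast
  \<comment> \<open>Solutions are extensional, so the element \<open>y\<close> is turned into a point of \<open>H\<^sup>1\<close>.\<close>
  have "(\<lambda>i\<in>{1..1}. y) \<in> solutions H g 1 S'"
    unfolding B(3) solutions_commuting_eqs using y by auto
  then have "(\<lambda>i\<in>{1..1}. y) \<in> solutions H g 1 {?e}"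
    using sub by blast
  then show False
    unfolding solutions_commuting_eq using y by simp
qed

text \<open>
  Commutation in the power is coordinatewise, and off the coordinate \<open>k\<close> the constant only
  offers the central \<open>c\<close>.
\<close>

lemma commutes_with_spike_iff:
  assumes "c \<in> magma_center M f" "y \<in> power_carrier M"
  shows "power_op f y ((\<lambda>_. c)(k := a)) = power_op f ((\<lambda>_. c)(k := a)) y
    \<longleftrightarrow> f (y k) a = f a (y k)"
  using assms by (auto simp: power_op_def fun_eq_iff magma_center_def power_carrier_def)

theorem theorem3p8:
  fixes M :: "'a set" and f :: "'a \<Rightarrow> 'a \<Rightarrow> 'a"
  assumes "magma M f"
    and "\<not> commutative_magma M f"
    and "magma_center M f \<noteq> {}"
  shows "\<not> q_omega_compact (power_carrier M) (power_op f)"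
proof -
  obtain a b where ab: "a \<in> M" "b \<in> M" "f a b \<noteq> f b a"
    using assms(1,2) by (auto simp: commutative_magma_def)
  obtain c where c: "c \<in> magma_center M f"
    using assms(3) by blast
  then have "c \<in> M" and comm_c: "\<And>x. x \<in> M \<Longrightarrow> f c x = f x c"
    by (auto simp: magma_center_def)
  define spike where "spike v k = (\<lambda>_. c)(k := v)" for v :: 'a and k :: nat
  have spike_in: "spike v k \<in> power_carrier M" if "v \<in> M" for v k
    using that \<open>c \<in> M\<close> by (simp add: spike_def power_carrier_def)
  note commutes_iff = commutes_with_spike_iff[OF c, folded spike_def]
  \<comment> \<open>The element \<open>a\<close> is not central, so the spikes \<open>spike a k\<close> are pairwise distinct.\<close>
  have "a \<noteq> c"
    using ab comm_c by auto
  then have inj: "inj (spike a)"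
    by (auto simp: inj_def spike_def fun_eq_iff split: if_splits)
  show ?thesis
  proof (rule not_q_omega_compact_if_commuting_not_finitary
      [where A = "range (spike a)" and d = "\<lambda>_. a"])
    show "infinite (range (spike a))"
      by (simp add: finite_image_iff[OF inj])
    show "range (spike a) \<subseteq> power_carrier M" "(\<lambda>_. a) \<in> power_carrier M"
      using spike_in ab(1) by (auto simp: power_carrier_def)
    show "power_op f y (\<lambda>_. a) = power_op f (\<lambda>_. a) y"
      if "y \<in> power_carrier M" "\<forall>h\<in>range (spike a). power_op f y h = power_op f h y" for y
      using that by (simp add: commutes_iff) (simp add: power_op_def)
    fix B assume "finite B" "B \<subseteq> range (spike a)"
    then obtain J where J: "finite J" "B = spike a ` J"
      using finite_subset_image[of B "spike a" UNIV] by blast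
    then obtain k where k: "k \<notin> J"
      using ex_new_if_finite infinite_UNIV_nat by blast
    have "power_op f (spike b k) (spike a j) = power_op f (spike a j) (spike b k)" if "j \<in> J" for j
    proof -
      have "spike b k j = c"
        using that k by (auto simp: spike_def)
      then show ?thesis
        unfolding commutes_iff[OF spike_in[OF ab(2)]] using comm_c[OF ab(1)] by simp
    qed
    moreover have "power_op f (spike b k) (\<lambda>_. a) \<noteq> power_op f (\<lambda>_. a) (spike b k)"
      using ab(3) by (auto simp: power_op_def spike_def dest!: fun_cong[of _ _ k])
    ultimately show "\<exists>y\<in>power_carrier M. (\<forall>h\<in>B. power_op f y h = power_op f h y)
        \<and> power_op f y (\<lambda>_. a) \<noteq> power_op f (\<lambda>_. a) y"
      using J(2) spike_in[OF ab(2)] by blast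
  qed
qed

end
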